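(* Every real three-dimensional normed space $X$ possesses a two-dimensional subspace $Y$ such that $\lambda(Y, X) < \frac{4}{3} - 0.0007$.
   Context: All normed spaces are real. For a subspace $Y$ of a normed space $X$, a projection from $X$ onto $Y$ is a bounded linear operator $P: X \to Y$ with $P|_Y = \mathrm{Id}_Y$; the relative projection constant $\lambda(Y,X)$ is the infimum of $\|P\|$ over all projections $P$ from $X$ onto $Y$. *)

theory Defs
  imports "HOL-Analysis.Analysis"
begin

definition projections_onto :: "'a::real_normed_vector set \<Rightarrow> ('a \<Rightarrow> 'a) set" where
  "projections_onto Y = {P. bounded_linear P \<and> range P \<subseteq> Y \<and> (\<forall>y\<in>Y. P y = y)}"

(* The ambient space is the whole type.  The infimum is taken in the extended reals,
   so the constant is infinite when there is no bounded projection onto Y. *)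
definition rel_proj_const :: "'a::real_normed_vector set \<Rightarrow> ereal" where
  "rel_proj_const Y = (INF P\<in>projections_onto Y. ereal (onorm P))"

end

theory Submission
  imports Defs
begin

text \<open>
  Bohnenblust's theorem bounds the relative projection constant of a plane in a three-dimensional
  space by \<open>4/3\<close>. The idea is that near-equality for one plane determines the shape of the unit
  ball so well that a projection of much smaller norm can be written down for another plane.

  Fix any plane \<open>Y\<close>, the kernel of a functional \<open>f\<close>. Duality (\<open>extremal_configuration\<close>) certifies that \<open>Y\<close>
  has no projection of norm at most \<open>c\<close> by three points \<open>x i\<close> of the unit ball, three functionals \<open>g i\<close> of
  norm at most \<open>1\<close>, and weights \<open>\<beta> i\<close> such that \<open>\<Sum>i. \<beta> i * f (x i) * g i = \<kappa> * f\<close> and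
  \<open>(\<Sum>i. \<beta> i * g i (x i)) - \<kappa> \<ge> c\<close>. Evaluating the first relation at the points \<open>x j\<close> and using only
  \<open>\<bar>g i (x j)\<bar> \<le> 1\<close>, a convexity argument gives \<open>c \<le> 4/3\<close>. Equality forces \<open>g i (x i) = 1\<close> and
  \<open>g i (x j) = -1\<close> for \<open>i \<noteq> j\<close>, and the quantitative form of this is \<open>near_equality_bounds\<close>: for
  \<open>c = 4/3 - 1/1000\<close> the entries deviate from these values by at most \<open>1/15\<close>.

  In the equality case the unit ball lies between the octahedron with vertices \<open>\<plusminus> x i\<close> and the
  parallelepiped with faces \<open>g i = \<plusminus> 1\<close>. Of the latter, all vertices are vertices of the octahedron except
  \<open>\<plusminus> (x 1 + x 2 + x 3)\<close>. The projection onto the span of \<open>x 1\<close> and \<open>x 2\<close> along \<open>(x 1 + x 2)/2 + x 3\<close>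
  maps the whole parallelepiped into the octahedron, so its norm is \<open>1\<close>. Under the small deviation above
  the same construction still gives norm at most \<open>5/4\<close> (\<open>projection_from_almost_cube\<close>), well below \<open>4/3\<close>.
\<close>

section \<open>Convex combinations of few points\<close>

text \<open>Caratheodory's theorem needs \<open>DIM + 1\<close> points. One point can be saved at the price of
  moving \<open>y\<close> in the direction \<open>e\<close>: at the last moment before the ray leaves the convex hull
  of these points, it lies on a facet. The saved point is decisive for the
  application: the bound \<open>4/3\<close> comes from three pairs, and four would only give \<open>3/2\<close>.\<close>

lemma convex_hull_shift_to_boundary:
  fixes S :: "'a::euclidean_space set"
  assumes y: "y \<in> convex hull S" and e: "e \<noteq> 0"
  obtains r T where "0 \<le> r" "finite T" "T \<subseteq> S" "card T \<le> DIM('a)" "y + r *\<^sub>R e \<in> convex hull T"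
proof -
  obtain T where T: "finite T" "T \<subseteq> S" "card T \<le> DIM('a) + 1" "y \<in> convex hull T"
    using y unfolding caratheodory[of S] by blast
  show ?thesis
  proof (cases "card T = Suc DIM('a)")
    case False
    with T that[of 0 T] show ?thesis by simp
  next
    case card: True
    let ?K = "convex hull T"
    let ?R = "{r. 0 \<le> r \<and> y + r *\<^sub>R e \<in> ?K}"
    have K: "compact ?K"
      by (simp add: T(1) finite_imp_compact_convex_hull)
    have "closed ?R"
    proof -
      have "?R = {0..} \<inter> (\<lambda>r. y + r *\<^sub>R e) -` ?K" by auto
      moreover have "closed ((\<lambda>r. y + r *\<^sub>R e) -` ?K)"
        by (intro continuous_closed_vimage continuous_intros compact_imp_closed K)
      ultimately show ?thesis by (simp only: closed_Int closed_atLeast)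
    qed
    moreover have "bounded ?R"
    proof -
      obtain M where M: "\<And>z. z \<in> ?K \<Longrightarrow> norm z \<le> M"
        using compact_imp_bounded[OF K] unfolding bounded_iff by blast
      have "norm r \<le> (M + norm y) / norm e" if "r \<in> ?R" for r
      proof -
        have "r * norm e = norm ((y + r *\<^sub>R e) - y)" using that by simp
        also have "\<dots> \<le> M + norm y" using M[of "y + r *\<^sub>R e"] that norm_triangle_ineq4[of "y + r *\<^sub>R e" y] by simp
        finally show ?thesis using that e by (simp add: field_simps)
      qed
      then show ?thesis unfolding bounded_iff by blast
    qed
    ultimately have "compact ?R" by (simp add: compact_eq_bounded_closed)
    moreover have "?R \<noteq> {}" using T(4) by (auto intro!: exI[of _ 0])
    ultimately obtain r where r: "r \<in> ?R" and rmax: "\<And>s. s \<in> ?R \<Longrightarrow> s \<le> r"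
      using compact_attains_sup[of ?R] by blast
    have "y + r *\<^sub>R e \<notin> interior ?K"
    proof
      assume "y + r *\<^sub>R e \<in> interior ?K"
      then obtain d where d: "d > 0" "ball (y + r *\<^sub>R e) d \<subseteq> ?K"
        using mem_interior by blast
      define h where "h = d / (2 * norm e)"
      have h: "h > 0" "h * norm e < d" using d(1) e by (auto simp: h_def field_simps)
      have "y + (r + h) *\<^sub>R e \<in> ball (y + r *\<^sub>R e) d"
        using h by (simp add: dist_norm algebra_simps)
      then have "r + h \<in> ?R" using d r h by auto
      from rmax[OF this] h show False by simp
    qed
    then have "y + r *\<^sub>R e \<in> frontier ?K"
      using r K closure_subset[of ?K] by (auto simp: frontier_def)
    then obtain a where a: "a \<in> T" "y + r *\<^sub>R e \<in> convex hull (T - {a})"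
      using frontier_of_convex_hull[OF card] by auto
    show ?thesis
      by (rule that[of r "T - {a}"]) (use r a T card in auto)
  qed
qed

text \<open>Indexing by the type \<open>3\<close>, with repetitions if the set is smaller, avoids a case distinction
  on the number of points later on.\<close>

lemma convex_hull_card_le_3:
  assumes "finite T" "card T \<le> 3" "y \<in> convex hull T"
  obtains v :: "3 \<Rightarrow> 'a::real_vector" and b :: "3 \<Rightarrow> real"
  where "\<And>i. v i \<in> T" "\<And>i. 0 \<le> b i" "sum b UNIV = 1" "(\<Sum>i\<in>UNIV. b i *\<^sub>R v i) = y"
proof -
  have "T \<noteq> {}" using assms(3) by auto
  then have "card T = 1 \<or> card T = 2 \<or> card T = 3"
    using assms(1,2) card_gt_0_iff[of T] by linarith
  then have "\<exists>p q r. T = {p, q, r}"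
  proof (elim disjE)
    assume "card T = 1"
    then obtain p where "T = {p, p, p}" by (auto simp: card_1_singleton_iff)
    then show ?thesis by blast
  next
    assume "card T = 2"
    then obtain p q where "T = {p, q, q}" by (auto simp: card_2_iff)
    then show ?thesis by blast
  qed (auto simp: card_3_iff)
  then obtain p q r where T: "T = {p, q, r}" by blast
  obtain u1 u2 u3 where u: "0 \<le> u1" "0 \<le> u2" "0 \<le> u3" "u1 + u2 + u3 = (1::real)"
      "u1 *\<^sub>R p + u2 *\<^sub>R q + u3 *\<^sub>R r = y"
    using assms(3) unfolding T convex_hull_3 by blast
  let ?c = "\<lambda>x1 x2 x3 (i::3). if i = 1 then x1 else if i = 2 then x2 else x3"
  show ?thesis
    by (rule that[of "?c p q r" "?c u1 u2 u3"]) (use u T in \<open>auto simp: sum_3\<close>)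
qed

section \<open>Norms on Euclidean spaces and their polars\<close>

text \<open>A norm on the vectors of a Euclidean space is kept apart from the Euclidean norm \<open>norm\<close>, so that
  compactness and separation are available for it; functionals are represented by the inner
  product.\<close>

locale euclidean_norm =
  fixes N :: "'a::euclidean_space \<Rightarrow> real"
  assumes triangle: "N (x + y) \<le> N x + N y"
    and scale: "N (r *\<^sub>R x) = \<bar>r\<bar> * N x"
    and definite: "N x = 0 \<Longrightarrow> x = 0"
begin

definition polar :: "'a set" where
  "polar = {g. \<forall>x. g \<bullet> x \<le> N x}"

lemma N_zero [simp]: "N 0 = 0"
  using scale[of 0 0] by simp

lemma N_minus [simp]: "N (- x) = N x"
  using scale[of "-1" x] by simp

lemma N_nonneg: "0 \<le> N x"
  using triangle[of x "- x"] by simp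

lemma abs_polar_le: "g \<in> polar \<Longrightarrow> \<bar>g \<bullet> x\<bar> \<le> N x"
  unfolding polar_def using N_minus[of x] spec[of "\<lambda>x. g \<bullet> x \<le> N x" "- x"] by (auto simp: abs_le_iff)

lemma N_convex: "convex_on UNIV N"
  by (rule convex_onI) (auto intro: order_trans[OF triangle] simp: scale)

lemma N_continuous: "continuous_on S N"
  using convex_on_continuous[OF open_UNIV N_convex] continuous_on_subset by blast

lemma norm_equivalence:
  obtains m M where "0 < m" "\<And>x. m * norm x \<le> N x" "\<And>x. N x \<le> M * norm x"
proof -
  let ?S = "sphere (0::'a) 1"
  obtain b :: 'a where "b \<in> Basis" using nonempty_Basis by blast
  then have ne: "?S \<noteq> {}" by (auto intro!: exI[of _ b])
  obtain p where p: "p \<in> ?S" "\<And>x. x \<in> ?S \<Longrightarrow> N p \<le> N x"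
    using continuous_attains_inf[OF compact_sphere ne N_continuous] by blast
  obtain q where q: "q \<in> ?S" "\<And>x. x \<in> ?S \<Longrightarrow> N x \<le> N q"
    using continuous_attains_sup[OF compact_sphere ne N_continuous] by blast
  have eq: "N x = norm x * N (x /\<^sub>R norm x)" if "x \<noteq> 0" for x
    using that by (simp add: scale)
  have on_sphere: "x /\<^sub>R norm x \<in> ?S" if "x \<noteq> 0" for x
    using that by simp
  show ?thesis
  proof
    have "N p \<noteq> 0" using definite[of p] p(1) by auto
    then show "0 < N p" using N_nonneg[of p] by simp
    show "N p * norm x \<le> N x" for x
      using eq[of x] p(2)[OF on_sphere, of x] by (cases "x = 0") (simp_all add: mult.commute mult_left_mono)
    show "N x \<le> N q * norm x" for x
      using eq[of x] q(2)[OF on_sphere, of x] by (cases "x = 0") (simp_all add: mult.commute mult_left_mono)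
  qed
qed

lemma closed_sublevel: "closed {x. N x \<le> r}"
  by (rule closed_Collect_le[OF N_continuous continuous_on_const])

lemma compact_sublevel: "compact {x. N x \<le> r}"
proof -
  obtain m M where m: "0 < m" "\<And>x. m * norm x \<le> N x" "\<And>x. N x \<le> M * norm x"
    by (rule norm_equivalence) blast
  have "norm x \<le> r / m" if "N x \<le> r" for x
    using m(1) order_trans[OF m(2)[of x] that] by (simp add: pos_le_divide_eq mult.commute)
  then have "bounded {x. N x \<le> r}" unfolding bounded_iff by blast
  then show ?thesis using closed_sublevel by (simp add: compact_eq_bounded_closed)
qed

lemma convex_sublevel: "convex {x. N x \<le> r}"
proof (rule convexI)
  fix x y :: 'a and u v :: real
  assume a: "x \<in> {x. N x \<le> r}" "y \<in> {x. N x \<le> r}" "0 \<le> u" "0 \<le> v" "u + v = 1"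
  have "N (u *\<^sub>R x + v *\<^sub>R y) \<le> u * N x + v * N y"
    using triangle[of "u *\<^sub>R x" "v *\<^sub>R y"] a by (simp add: scale)
  also have "\<dots> \<le> r" using a convex_bound_le by simp
  finally show "u *\<^sub>R x + v *\<^sub>R y \<in> {x. N x \<le> r}" by simp
qed

lemma compact_polar: "compact polar"
proof -
  obtain m M where "0 < m" "\<And>x. m * norm x \<le> N x" and M: "\<And>x. N x \<le> M * norm x"
    by (rule norm_equivalence) blast
  have "norm g \<le> M" if "g \<in> polar" for g
  proof (cases "g = 0")
    case False
    have "norm g * norm g = g \<bullet> g" by (simp add: power2_norm_eq_inner flip: power2_eq_square)
    also have "\<dots> \<le> M * norm g" using that M[of g] unfolding polar_def by (blast intro: order_trans)
    finally show ?thesis using False by simp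
  next
    case True
    obtain b :: 'a where "b \<in> Basis" using nonempty_Basis by blast
    then show ?thesis using True M[of b] N_nonneg[of b] by simp
  qed
  then have "bounded polar" unfolding bounded_iff by blast
  moreover have "polar = (\<Inter>x. {g. x \<bullet> g \<le> N x})" by (auto simp: polar_def inner_commute)
  then have "closed polar" by (auto intro: closed_halfspace_le)
  ultimately show ?thesis by (simp add: compact_eq_bounded_closed)
qed

text \<open>This is the Hahn-Banach theorem for \<open>N\<close>: a point outside a sublevel set is separated from it by a
  hyperplane, and the separating functional, rescaled, belongs to the polar.\<close>

lemma N_le_by_polar:
  assumes "0 < c" "\<And>g. g \<in> polar \<Longrightarrow> g \<bullet> v \<le> c"
  shows "N v \<le> c"
proof (rule ccontr)
  assume "\<not> N v \<le> c"
  then have "v \<notin> {x. N x \<le> c}" by simp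
  then obtain a b where ab: "a \<bullet> v < b" "\<And>x. N x \<le> c \<Longrightarrow> b < a \<bullet> x"
    using separating_hyperplane_closed_point[OF convex_sublevel closed_sublevel, of v c] by auto
  have b: "b < 0" using ab(2)[of 0] \<open>0 < c\<close> by simp
  let ?g = "(c / b) *\<^sub>R a"
  have "?g \<bullet> x \<le> N x" for x
  proof (cases "x = 0")
    case False
    then have Nx: "N x > 0" using N_nonneg[of x] definite[of x] by fastforce
    have "b < a \<bullet> ((c / N x) *\<^sub>R x)" using Nx \<open>0 < c\<close> by (intro ab(2)) (simp add: scale)
    then show ?thesis using Nx b by (simp add: field_simps)
  qed simp
  then have "?g \<in> polar" by (simp add: polar_def)
  from assms(2)[OF this] show False using ab(1) b \<open>0 < c\<close> by (simp add: field_simps)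
qed

end

section \<open>Stability in Bohnenblust's inequality\<close>

text \<open>With \<open>E = 0\<close>, multiplying the inequality by \<open>\<beta> j\<close> and writing \<open>\<rho> j\<close> for the normalized
  \<open>\<beta> j * t j\<close> gives \<open>\<mu> * h (\<rho> j) \<le> \<beta> j\<close> for the convex function \<open>h \<rho> = \<rho> / (1 - 2 * \<rho>)\<close>. Both \<open>\<rho>\<close> and
  \<open>\<beta>\<close> sum to \<open>1\<close>, and \<open>h (1/3) = 1\<close>, so Jensen's inequality yields \<open>\<mu> \<le> 1/3\<close>; this is Bohnenblust's
  bound. If \<open>\<mu>\<close> is close to \<open>1/3\<close>, strict convexity forces all \<open>\<rho> j\<close> to be close to \<open>1/3\<close>, hence bounded
  away from \<open>0\<close>, and then the terms with \<open>E\<close>, which sum to at most \<open>1 - 3 * \<mu>\<close> after weighting,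
  must be small. The numerical bounds are generous.\<close>

lemma near_equality_bounds:
  fixes \<beta> t :: "3 \<Rightarrow> real" and E :: "3 \<Rightarrow> 3 \<Rightarrow> real"
  assumes \<beta>: "\<And>i. 0 \<le> \<beta> i" "sum \<beta> UNIV = 1"
    and t: "\<And>i. 0 \<le> t i" and T: "0 < (\<Sum>i\<in>UNIV. \<beta> i * t i)"
    and E: "\<And>i j. 0 \<le> E i j"
    and \<mu>: "1/3 - 1/1000 \<le> \<mu>"
    and ineq: "\<And>j. t j * (2 * \<beta> j + \<mu>) + t j * (\<Sum>i\<in>UNIV - {j}. \<beta> i * E i i)
        + (\<Sum>i\<in>UNIV - {j}. \<beta> i * t i * E i j) \<le> (\<Sum>i\<in>UNIV. \<beta> i * t i)"
  shows "E i j \<le> 1/15"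
proof -
  define T where "T = (\<Sum>i\<in>UNIV. \<beta> i * t i)"
  have T0: "0 < T" using T by (simp add: T_def)
  define \<tau> where "\<tau> j = t j / T" for j
  define \<rho> where "\<rho> j = \<beta> j * \<tau> j" for j
  define D where "D j = \<tau> j * (\<Sum>i\<in>UNIV - {j}. \<beta> i * E i i) + (\<Sum>i\<in>UNIV - {j}. \<rho> i * E i j)" for j
  have \<tau>: "0 \<le> \<tau> j" for j using t T0 by (simp add: \<tau>_def)
  have \<rho>: "0 \<le> \<rho> j" for j using \<tau> \<beta> by (simp add: \<rho>_def)
  have sum_\<rho>: "sum \<rho> UNIV = 1"
    using T0 by (simp add: \<rho>_def \<tau>_def T_def flip: sum_divide_distrib)
  have D0: "0 \<le> D j" for j
    unfolding D_def using \<tau> \<rho> \<beta> E by (intro add_nonneg_nonneg mult_nonneg_nonneg sum_nonneg) auto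
  have normalized: "\<tau> j * (2 * \<beta> j + \<mu>) + D j \<le> 1" for j
  proof -
    have "t j * (2 * \<beta> j + \<mu>) + t j * (\<Sum>i\<in>UNIV - {j}. \<beta> i * E i i)
        + (\<Sum>i\<in>UNIV - {j}. \<beta> i * t i * E i j) = T * (\<tau> j * (2 * \<beta> j + \<mu>) + D j)"
      using T0 by (simp add: D_def \<tau>_def \<rho>_def sum_distrib_left distrib_left mult.assoc)
    then have "T * (\<tau> j * (2 * \<beta> j + \<mu>) + D j) \<le> T * 1" using ineq[of j] by (simp add: T_def)
    then show ?thesis using T0 by simp
  qed
  have weighted: "\<mu> * \<rho> j + \<beta> j * D j \<le> \<beta> j * (1 - 2 * \<rho> j)" for j
    using mult_left_mono[OF normalized[of j] \<beta>(1)[of j]] by (simp add: \<rho>_def algebra_simps)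
  have r: "0 < 1 - 2 * \<rho> j" for j
  proof (cases "\<rho> j = 0")
    case False
    then have "0 < \<mu> * \<rho> j + \<beta> j * D j" using \<rho>[of j] \<beta>(1)[of j] D0[of j] \<mu> by (simp add: add_pos_nonneg)
    with weighted[of j] have "0 < \<beta> j * (1 - 2 * \<rho> j)" by linarith
    then show ?thesis using \<beta>(1)[of j] by (simp add: zero_less_mult_iff)
  qed simp
  \<comment> \<open>The tangent parabola below \<open>h\<close> at \<open>1/3\<close>: the slope is \<open>9\<close>, and the defect
    \<open>36 * (e j)\<^sup>2 * \<rho> j / (1 - 2 * \<rho> j)\<close> is nonnegative.\<close>
  define e where "e j = \<rho> j - 1/3" for j
  have tangent: "\<mu> * (1 + 9 * e j + 18 * (e j)\<^sup>2) + \<beta> j * D j / (1 - 2 * \<rho> j) \<le> \<beta> j" for j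
  proof -
    have "\<rho> j - (1 + 9 * e j + 18 * (e j)\<^sup>2) * (1 - 2 * \<rho> j) = 36 * (e j)\<^sup>2 * \<rho> j"
      unfolding e_def by (simp add: power2_eq_square algebra_simps)
    then have "(1 + 9 * e j + 18 * (e j)\<^sup>2) * (1 - 2 * \<rho> j) \<le> \<rho> j" using \<rho>[of j] by (smt (verit) mult_nonneg_nonneg zero_le_power2)
    then have "\<mu> * ((1 + 9 * e j + 18 * (e j)\<^sup>2) * (1 - 2 * \<rho> j)) \<le> \<mu> * \<rho> j"
      using \<mu> by (intro mult_left_mono) auto
    with weighted[of j] have "(\<mu> * (1 + 9 * e j + 18 * (e j)\<^sup>2)) * (1 - 2 * \<rho> j) + \<beta> j * D j \<le> \<beta> j * (1 - 2 * \<rho> j)"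
      by (simp only: mult.assoc)
    then show ?thesis using r[of j] by (simp add: field_simps)
  qed
  have excess: "0 \<le> \<beta> j * D j / (1 - 2 * \<rho> j)" for j
    using \<beta>(1)[of j] D0[of j] r[of j] by simp
  have sum_e: "sum e UNIV = 0" using sum_\<rho> by (simp add: e_def sum_subtractf)
  have total: "3 * \<mu> + 18 * \<mu> * (\<Sum>j\<in>UNIV. (e j)\<^sup>2) + (\<Sum>j\<in>UNIV. \<beta> j * D j / (1 - 2 * \<rho> j)) \<le> 1"
  proof -
    have "3 * \<mu> + 18 * \<mu> * (\<Sum>j\<in>UNIV. (e j)\<^sup>2) + (\<Sum>j\<in>UNIV. \<beta> j * D j / (1 - 2 * \<rho> j))
        = (\<Sum>j\<in>UNIV. \<mu> * (1 + 9 * e j + 18 * (e j)\<^sup>2) + \<beta> j * D j / (1 - 2 * \<rho> j)) - 9 * \<mu> * sum e UNIV"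
      by (simp add: sum_3 algebra_simps)
    also have "\<dots> \<le> sum \<beta> UNIV" using sum_mono[of UNIV, OF tangent] by (simp add: sum_e)
    finally show ?thesis using \<beta>(2) by simp
  qed
  have "0 \<le> (\<Sum>j\<in>UNIV. (e j)\<^sup>2)" by (simp add: sum_nonneg)
  have e_small: "\<bar>e j\<bar> \<le> 23/1000" for j
  proof -
    have "18 * (1/3 - 1/1000) * (\<Sum>j\<in>UNIV. (e j)\<^sup>2) \<le> 18 * \<mu> * (\<Sum>j\<in>UNIV. (e j)\<^sup>2)"
      using \<mu> \<open>0 \<le> (\<Sum>j\<in>UNIV. (e j)\<^sup>2)\<close> by (intro mult_right_mono) auto
    moreover have "0 \<le> (\<Sum>j\<in>UNIV. \<beta> j * D j / (1 - 2 * \<rho> j))" using excess by (intro sum_nonneg) auto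
    moreover have "(e j)\<^sup>2 \<le> (\<Sum>j\<in>UNIV. (e j)\<^sup>2)" by (rule member_le_sum) auto
    ultimately have "(e j)\<^sup>2 \<le> (23/1000)\<^sup>2" using total \<mu> by (simp add: power2_eq_square)
    then show ?thesis using power2_le_iff_abs_le[of "23/1000" "e j"] by simp
  qed
  have \<rho>_low: "31/100 \<le> \<rho> j" for j using e_small[of j] unfolding e_def by linarith
  have \<beta>_low: "26/100 \<le> \<beta> j" for j
  proof -
    have e_low: "1 - 9 * (23/1000) \<le> 1 + 9 * e j + 18 * (e j)\<^sup>2"
      using e_small[of j] zero_le_power2[of "e j"] by linarith
    have "(1/3 - 1/1000) * (1 - 9 * (23/1000)) \<le> \<mu> * (1 + 9 * e j + 18 * (e j)\<^sup>2)"
      using \<mu> e_low by (intro mult_mono) auto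
    with tangent[of j] excess[of j] show ?thesis by simp
  qed
  have D_small: "D j \<le> 5/1000" for j
  proof -
    have "\<beta> j * D j / (1 - 2 * \<rho> j) \<le> (\<Sum>j\<in>UNIV. \<beta> j * D j / (1 - 2 * \<rho> j))"
      using excess by (intro member_le_sum) auto
    moreover have "0 \<le> 18 * \<mu> * (\<Sum>j\<in>UNIV. (e j)\<^sup>2)" using \<mu> \<open>0 \<le> (\<Sum>j\<in>UNIV. (e j)\<^sup>2)\<close> by simp
    ultimately have "\<beta> j * D j / (1 - 2 * \<rho> j) \<le> 3/1000" using total \<mu> by linarith
    then have "\<beta> j * D j \<le> 3/1000 * (1 - 2 * \<rho> j)" using r[of j] by (simp add: pos_divide_le_eq)
    moreover have "26/100 * D j \<le> \<beta> j * D j" using \<beta>_low D0 by (intro mult_right_mono)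
    ultimately show ?thesis using \<rho>_low[of j] by simp
  qed
  show ?thesis
  proof (cases "i = j")
    case False
    have "\<rho> i * E i j \<le> (\<Sum>i\<in>UNIV - {j}. \<rho> i * E i j)"
      using False \<rho> E by (intro member_le_sum) auto
    also have "\<dots> \<le> D j" using \<tau> \<beta> E by (auto simp: D_def intro!: mult_nonneg_nonneg sum_nonneg)
    finally have "\<rho> i * E i j \<le> 5/1000" using D_small[of j] by simp
    moreover have "31/100 * E i j \<le> \<rho> i * E i j" using \<rho>_low E by (intro mult_right_mono)
    ultimately show ?thesis by simp
  next
    case True
    \<comment> \<open>Diagonal entries \<open>E i i\<close> occur only in the inequalities of the other indices.\<close>
    obtain k where k: "k \<noteq> i" by (metis exhaust_3 zero_neq_one)
    have "\<beta> i * E i i \<le> (\<Sum>i\<in>UNIV - {k}. \<beta> i * E i i)"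
      using k \<beta> E by (intro member_le_sum) auto
    then have "\<tau> k * (\<beta> i * E i i) \<le> \<tau> k * (\<Sum>i\<in>UNIV - {k}. \<beta> i * E i i)"
      using \<tau> by (intro mult_left_mono)
    also have "\<dots> \<le> D k" using \<rho> E by (auto simp: D_def intro!: mult_nonneg_nonneg sum_nonneg)
    finally have *: "\<tau> k * (\<beta> i * E i i) \<le> 5/1000" using D_small[of k] by simp
    have "31/100 \<le> \<tau> k"
    proof -
      have "\<beta> k \<le> 1" using member_le_sum[of k UNIV \<beta>] \<beta> by simp
      then have "\<rho> k \<le> \<tau> k" using \<tau>[of k] by (simp add: \<rho>_def mult_left_le_one_le \<beta>(1))
      then show ?thesis using \<rho>_low[of k] by simp
    qed
    then have "31/100 * (26/100 * E i i) \<le> \<tau> k * (\<beta> i * E i i)"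
      using \<beta>_low E \<tau> \<beta> by (intro mult_mono) auto
    with * True show ?thesis by simp
  qed
qed

section \<open>Duality for projections onto a plane\<close>

lemma inner_3: "(u::real^3) \<bullet> v = u$1 * v$1 + u$2 * v$2 + u$3 * v$3"
  by (simp add: inner_vec_def sum_3)

locale norm_on_R3 = euclidean_norm N for N :: "real^3 \<Rightarrow> real"
begin

lemma polar_minus: "g \<in> polar \<Longrightarrow> - g \<in> polar"
  using abs_polar_le[of g] by (auto simp: polar_def abs_le_iff)

text \<open>This is duality for the problem of finding the best projection onto the plane \<open>x$3 = 0\<close>. A
  projection onto it is \<open>x \<mapsto> x - x$3 *\<^sub>R w\<close> with \<open>w$3 = 1\<close>, and the condition that its norm is at most \<open>c\<close>
  is a family of linear inequalities in \<open>w\<close>, one for every \<open>x\<close> in the unit ball and \<open>g\<close> in the polar.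
  If the system has no solution, then a convex combination of the inequalities is contradictory,
  which means that \<open>w\<close> cancels. As \<open>w\<close> varies in a plane, three inequalities are
  enough. The third coordinates of the \<open>x i\<close> can be made nonnegative because \<open>(x, g)\<close> and
  \<open>(-x, -g)\<close> give the same inequality.\<close>

lemma extremal_configuration:
  assumes c: "0 < c" and no_projection: "\<And>a b. \<exists>x. N (x - x$3 *\<^sub>R vector [a, b, 1]) > c * N x"
  obtains x g :: "3 \<Rightarrow> real^3" and \<beta> :: "3 \<Rightarrow> real" and \<kappa> :: real
  where "\<And>i. N (x i) \<le> 1" "\<And>i. g i \<in> polar" "\<And>i. 0 \<le> x i $ 3"
    "\<And>i. 0 \<le> \<beta> i" "sum \<beta> UNIV = 1"
    "\<And>v. (\<Sum>i\<in>UNIV. \<beta> i * x i $ 3 * (g i \<bullet> v)) = \<kappa> * v $ 3"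
    "c + \<kappa> \<le> (\<Sum>i\<in>UNIV. \<beta> i * (g i \<bullet> x i))"
proof -
  \<comment> \<open>Up to sign, the first two coordinates are the coefficients of \<open>w$1\<close> and \<open>w$2\<close> in the
    inequality of \<open>(x, g)\<close>, the third one is its constant term.\<close>
  define \<Phi> :: "(real^3) \<times> (real^3) \<Rightarrow> real \<times> real \<times> real" where
    "\<Phi> = (\<lambda>(x, g). (x$3 * g$1, x$3 * g$2, x$1 * g$1 + x$2 * g$2))"
  define S where "S = \<Phi> ` ({x. N x \<le> 1} \<times> polar)"
  define L :: "(real \<times> real \<times> real) set" where "L = {0} \<times> {0} \<times> {c..}"
  have "compact S"
    unfolding S_def \<Phi>_def split_beta
    by (intro compact_continuous_image compact_Times compact_sublevel compact_polar continuous_intros)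
  then have hull: "compact (convex hull S)" by (rule compact_convex_hull)
  have zero: "0 \<in> S"
    unfolding S_def by (rule image_eqI[of _ _ "(0, 0)"]) (auto simp: \<Phi>_def polar_def N_nonneg zero_prod_def)
  have "convex hull S \<inter> L \<noteq> {}"
  proof
    assume disj: "convex hull S \<inter> L = {}"
    have L: "convex L" "closed L"
      unfolding L_def by (auto intro!: convex_Times closed_Times)
    have "convex hull S \<noteq> {}" using zero by auto
    from separating_hyperplane_compact_closed[OF convex_convex_hull hull this L disj]
    obtain a d where ad: "\<And>u. u \<in> convex hull S \<Longrightarrow> a \<bullet> u < d" "\<And>u. u \<in> L \<Longrightarrow> d < a \<bullet> u" by blast
    obtain p q r where a: "a = (p, q, r)" by (metis prod.exhaust)
    have "0 < d" using ad(1)[of 0] zero by (simp add: hull_inc)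
    have rc: "d < r * c" using ad(2)[of "(0, 0, c)"] by (simp add: L_def a)
    then have "0 < r * c" using \<open>0 < d\<close> by simp
    then have r: "0 < r" using c by (simp add: zero_less_mult_iff)
    \<comment> \<open>Scaled to \<open>r = 1\<close>, the separating functional contains, up to sign, the direction of a projection
      of norm at most \<open>c\<close>.\<close>
    let ?w = "vector [- p / r, - q / r, 1] :: real^3"
    have unit: "N (x - x$3 *\<^sub>R ?w) \<le> c" if x: "N x \<le> 1" for x
    proof (rule N_le_by_polar[OF c])
      fix g assume "g \<in> polar"
      then have "\<Phi> (x, g) \<in> S" using x by (auto simp: S_def)
      then have "a \<bullet> \<Phi> (x, g) < d" using ad(1) by (simp add: hull_inc)
      also note rc
      also have "a \<bullet> \<Phi> (x, g) = r * (g \<bullet> (x - x$3 *\<^sub>R ?w))"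
        using r by (simp add: a \<Phi>_def inner_3 field_simps)
      finally show "g \<bullet> (x - x$3 *\<^sub>R ?w) \<le> c" using r by simp
    qed
    have "N (x - x$3 *\<^sub>R ?w) \<le> c * N x" for x
    proof (cases "x = 0")
      case False
      then have Nx: "0 < N x" using N_nonneg[of x] definite[of x] by fastforce
      have "x - x$3 *\<^sub>R ?w = N x *\<^sub>R ((x /\<^sub>R N x) - (x /\<^sub>R N x)$3 *\<^sub>R ?w)"
        using Nx by (simp add: algebra_simps)
      then have "N (x - x$3 *\<^sub>R ?w) = N x * N ((x /\<^sub>R N x) - (x /\<^sub>R N x)$3 *\<^sub>R ?w)"
        using Nx scale by (metis abs_of_pos)
      also have "\<dots> \<le> N x * c" using Nx by (intro mult_left_mono unit) (simp_all add: scale)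
      finally show ?thesis by (simp add: mult.commute)
    qed simp
    with no_projection show False by (meson not_le)
  qed
  then obtain s where s: "c \<le> s" "(0, 0, s) \<in> convex hull S" by (auto simp: L_def)
  \<comment> \<open>Moving upwards only increases the value \<open>s\<close>, so the boundary of the hull can be reached.\<close>
  obtain r T where T: "0 \<le> r" "finite T" "T \<subseteq> S" "card T \<le> DIM(real \<times> real \<times> real)"
      "(0, 0, s) + r *\<^sub>R (0, 0, 1) \<in> convex hull T"
    by (rule convex_hull_shift_to_boundary[OF s(2), of "(0, 0, 1)"]) (auto simp: zero_prod_def)
  have "card T \<le> 3" using T(4) by simp
  obtain v :: "3 \<Rightarrow> real \<times> real \<times> real" and \<beta> where v: "\<And>i. v i \<in> T" and \<beta>: "\<And>i. 0 \<le> \<beta> i" "sum \<beta> UNIV = 1"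
      "(\<Sum>i\<in>UNIV. \<beta> i *\<^sub>R v i) = (0, 0, s) + r *\<^sub>R (0, 0, 1)"
    by (rule convex_hull_card_le_3[OF T(2) \<open>card T \<le> 3\<close> T(5)]) blast
  have "\<exists>x g. N x \<le> 1 \<and> g \<in> polar \<and> 0 \<le> x$3 \<and> v i = \<Phi> (x, g)" for i
  proof -
    obtain x g where xg: "N x \<le> 1" "g \<in> polar" "v i = \<Phi> (x, g)"
      using v[of i] T(3) by (auto simp: S_def)
    show ?thesis
    proof (cases "0 \<le> x$3")
      case False
      have "\<Phi> (- x, - g) = \<Phi> (x, g)" by (simp add: \<Phi>_def)
      then show ?thesis using xg False polar_minus[of g]
        by (intro exI[of _ "- x"] exI[of _ "- g"]) auto
    qed (use xg in blast)
  qed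
  then obtain x g where xg: "\<And>i. N (x i) \<le> 1" "\<And>i. g i \<in> polar" "\<And>i. 0 \<le> x i $ 3" "\<And>i. v i = \<Phi> (x i, g i)"
    by metis
  have coords: "(\<Sum>i\<in>UNIV. \<beta> i * x i $ 3 * g i $ 1) = 0" "(\<Sum>i\<in>UNIV. \<beta> i * x i $ 3 * g i $ 2) = 0"
      "(\<Sum>i\<in>UNIV. \<beta> i * (x i $ 1 * g i $ 1 + x i $ 2 * g i $ 2)) = s + r"
    using \<beta>(3) by (simp_all add: xg(4) \<Phi>_def sum_3 mult.assoc)
  let ?\<kappa> = "\<Sum>i\<in>UNIV. \<beta> i * x i $ 3 * g i $ 3"
  show ?thesis
  proof (rule that[of x g \<beta> ?\<kappa>])
    show "(\<Sum>i\<in>UNIV. \<beta> i * x i $ 3 * (g i \<bullet> v)) = ?\<kappa> * v $ 3" for v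
    proof -
      have "(\<Sum>i\<in>UNIV. \<beta> i * x i $ 3 * (g i \<bullet> v)) =
          (\<Sum>i\<in>UNIV. \<beta> i * x i $ 3 * g i $ 1) * v $ 1 + (\<Sum>i\<in>UNIV. \<beta> i * x i $ 3 * g i $ 2) * v $ 2 + ?\<kappa> * v $ 3"
        unfolding sum_3 inner_3 by (simp add: algebra_simps)
      then show ?thesis using coords by simp
    qed
    have "(\<Sum>i\<in>UNIV. \<beta> i * (g i \<bullet> x i)) =
        (\<Sum>i\<in>UNIV. \<beta> i * (x i $ 1 * g i $ 1 + x i $ 2 * g i $ 2)) + ?\<kappa>"
      unfolding sum_3 inner_3 by (simp add: algebra_simps)
    then show "c + ?\<kappa> \<le> (\<Sum>i\<in>UNIV. \<beta> i * (g i \<bullet> x i))"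
      using coords s(1) T(1) by simp
  qed (use xg \<beta> in auto)
qed

section \<open>A projection of small norm\<close>

text \<open>If the entries \<open>g i \<bullet> x j\<close> are exactly \<open>1\<close> on and \<open>-1\<close> off the diagonal, then the unit ball lies in
  the parallelepiped \<open>\<bar>g i \<bullet> z\<bar> \<le> 1\<close>, whose vertices are, up to sign, the points \<open>x i\<close> and
  \<open>x 1 + x 2 + x 3\<close>. The projection onto the span of \<open>x 1\<close> and \<open>x 2\<close> along \<open>(x 1 + x 2)/2 + x 3\<close> fixes
  \<open>x 1\<close> and \<open>x 2\<close> and maps the other two vertices to multiples of \<open>(x 1 + x 2)/2\<close> by \<open>-1\<close> and \<open>1\<close>, which are in the
  unit ball. So it has norm \<open>1\<close>, and there is ample room for perturbing the entries.\<close>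

lemma projection_from_almost_cube:
  fixes x g :: "3 \<Rightarrow> real^3"
  assumes x: "\<And>i. N (x i) \<le> 1" and g: "\<And>i. g i \<in> polar"
    and diag: "\<And>i. \<bar>g i \<bullet> x i - 1\<bar> \<le> 1/15"
    and off: "\<And>i j. i \<noteq> j \<Longrightarrow> \<bar>g i \<bullet> x j + 1\<bar> \<le> 1/15"
  obtains a w where "a \<bullet> w = 1" "\<And>z. N (z - (a \<bullet> z) *\<^sub>R w) \<le> 5/4 * N z"
proof -
  \<comment> \<open>\<open>M y\<close> is the vector with coordinates \<open>y\<close> with respect to the \<open>x i\<close>; that these are linearly
    independent is a consequence of the bounds on the entries.\<close>
  define M where "M y = y$1 *\<^sub>R x 1 + y$2 *\<^sub>R x 2 + y$3 *\<^sub>R x 3" for y :: "real^3"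
  define Y where "Y y = \<bar>y$1\<bar> + \<bar>y$2\<bar> + \<bar>y$3\<bar>" for y :: "real^3"
  have lin: "linear M" unfolding M_def by (intro linearI) (simp_all add: algebra_simps)
  have entry: "\<bar>u * (g i \<bullet> x j - s)\<bar> \<le> \<bar>u\<bar> / 15" if "\<bar>g i \<bullet> x j - s\<bar> \<le> 1/15" for u s :: real and i j
    using mult_left_mono[OF that abs_ge_zero[of u]] by (simp add: abs_mult)
  have face: "\<bar>y$1 - y$2 - y$3\<bar> \<le> N (M y) + Y y / 15"
    "\<bar>y$2 - y$1 - y$3\<bar> \<le> N (M y) + Y y / 15"
    "\<bar>y$3 - y$1 - y$2\<bar> \<le> N (M y) + Y y / 15" for y
  proof -
    have G: "\<bar>y$1 * (g i \<bullet> x 1) + y$2 * (g i \<bullet> x 2) + y$3 * (g i \<bullet> x 3)\<bar> \<le> N (M y)" for i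
      using abs_polar_le[OF g, of i "M y"] by (simp add: M_def inner_add_right)
    define d where "d j = \<bar>y$j\<bar> / 15" for j
    have d: "Y y / 15 = d 1 + d 2 + d 3" by (simp add: Y_def d_def)
    have ii: "\<bar>y$i * (g i \<bullet> x i) - y$i\<bar> \<le> d i" for i
      using entry[OF diag, of "y$i" i] by (simp add: d_def algebra_simps)
    have ne: "(1::3) \<noteq> 2" "(1::3) \<noteq> 3" "(2::3) \<noteq> 1" "(2::3) \<noteq> 3" "(3::3) \<noteq> 1" "(3::3) \<noteq> 2" by simp_all
    have ij: "\<bar>y$j * (g i \<bullet> x j) + y$j\<bar> \<le> d j" if "i \<noteq> j" for i j
      using entry[of i j "-1" "y$j"] off[OF that] by (simp add: d_def algebra_simps)
    show "\<bar>y$1 - y$2 - y$3\<bar> \<le> N (M y) + Y y / 15"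
      using G[of 1] ii[of 1] ij[OF ne(1)] ij[OF ne(2)] unfolding d by linarith
    show "\<bar>y$2 - y$1 - y$3\<bar> \<le> N (M y) + Y y / 15"
      using G[of 2] ii[of 2] ij[OF ne(3)] ij[OF ne(4)] unfolding d by linarith
    show "\<bar>y$3 - y$1 - y$2\<bar> \<le> N (M y) + Y y / 15"
      using G[of 3] ii[of 3] ij[OF ne(5)] ij[OF ne(6)] unfolding d by linarith
  qed
  have Y_le: "Y y \<le> 15/4 * N (M y)" for y
  proof -
    have "\<bar>y$1\<bar> \<le> N (M y) + Y y / 15" "\<bar>y$2\<bar> \<le> N (M y) + Y y / 15" "\<bar>y$3\<bar> \<le> N (M y) + Y y / 15"
      using face[of y] by linarith+
    moreover have "Y y = \<bar>y$1\<bar> + \<bar>y$2\<bar> + \<bar>y$3\<bar>" by (simp add: Y_def)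
    ultimately show ?thesis by linarith
  qed
  have "inj M"
  proof (subst linear_injective_0[OF lin], intro allI impI)
    fix y assume "M y = 0"
    then have "Y y \<le> 0" using Y_le[of y] by simp
    then have "y$1 = 0 \<and> y$2 = 0 \<and> y$3 = 0" unfolding Y_def by linarith
    then show "y = 0" by (simp add: vec_eq_iff forall_3)
  qed
  then obtain L where L: "linear L" "\<And>y. L (M y) = y" "\<And>z. M (L z) = z"
    using linear_injective_isomorphism[OF lin] by blast
  define a where "a = adjoint L (axis 3 1)"
  have a: "a \<bullet> z = L z $ 3" for z
    using adjoint_works[OF L(1), of z "axis 3 1"] by (simp add: a_def inner_commute inner_axis)
  define v :: "real^3" where "v = vector [1/2, 1/2, 1]"
  show ?thesis
  proof
    show "a \<bullet> M v = 1" by (simp add: a L(2) v_def)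
    fix z
    define y where "y = L z"
    have z: "z = M y" by (simp add: y_def L(3))
    have az: "a \<bullet> z = y$3" by (simp add: a y_def)
    have "z - (a \<bullet> z) *\<^sub>R M v = (y$1 - y$3/2) *\<^sub>R x 1 + (y$2 - y$3/2) *\<^sub>R x 2"
      unfolding az unfolding z by (simp add: M_def v_def algebra_simps)
    then have "N (z - (a \<bullet> z) *\<^sub>R M v) \<le> N ((y$1 - y$3/2) *\<^sub>R x 1) + N ((y$2 - y$3/2) *\<^sub>R x 2)"
      using triangle by simp
    also have "\<dots> \<le> \<bar>y$1 - y$3/2\<bar> + \<bar>y$2 - y$3/2\<bar>"
      unfolding scale using x by (intro add_mono mult_left_le) auto
    \<comment> \<open>By signs, the left-hand side is \<open>\<bar>y$1 + y$2 - y$3\<bar>\<close> or \<open>\<bar>y$1 - y$2\<bar>\<close>: the former belongs to the face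
      of \<open>g 3\<close>, the latter is half the difference of two others.\<close>
    also have "\<dots> \<le> N z + Y y / 15"
      using face[of y] unfolding z by linarith
    also have "\<dots> \<le> 5/4 * N z"
      using Y_le[of y] unfolding z by simp
    finally show "N (z - (a \<bullet> z) *\<^sub>R M v) \<le> 5/4 * N z" .
  qed
qed

text \<open>The plane \<open>x$3 = 0\<close> is an arbitrary choice. If it does not admit a good projection, it almost
  attains Bohnenblust's bound; then the dual configuration is almost that of a cube, and another
  plane does much better. Any constant slightly below \<open>4/3 - 0.0007\<close> would do.\<close>

lemma good_projection:
  "\<exists>a w. a \<bullet> w = 1 \<and> (\<forall>z. N (z - (a \<bullet> z) *\<^sub>R w) \<le> (4/3 - 1/1000) * N z)"
proof (rule ccontr)
  assume none: "\<not> ?thesis"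
  define c :: real where "c = 4/3 - 1/1000"
  have c: "0 < c" by (simp add: c_def)
  have "\<exists>z. N (z - z$3 *\<^sub>R vector [p, q, 1]) > c * N z" for p q
  proof -
    have "axis 3 1 \<bullet> (vector [p, q, 1] :: real^3) = 1" by (simp add: inner_axis')
    with none obtain z where "\<not> N (z - (axis 3 1 \<bullet> z) *\<^sub>R vector [p, q, 1]) \<le> c * N z"
      unfolding c_def by blast
    then show ?thesis by (auto simp: inner_axis' not_le)
  qed
  from extremal_configuration[OF c this]
  obtain x g :: "3 \<Rightarrow> real^3" and \<beta> :: "3 \<Rightarrow> real" and \<kappa>
    where x: "\<And>i. N (x i) \<le> 1" and g: "\<And>i. g i \<in> polar" and t: "\<And>i. 0 \<le> x i $ 3"
      and \<beta>: "\<And>i. 0 \<le> \<beta> i" "sum \<beta> UNIV = 1"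
      and balance: "\<And>v. (\<Sum>i\<in>UNIV. \<beta> i * x i $ 3 * (g i \<bullet> v)) = \<kappa> * v $ 3"
      and value_ge: "c + \<kappa> \<le> (\<Sum>i\<in>UNIV. \<beta> i * (g i \<bullet> x i))" by blast
  define E where "E i j = (if i = j then 1 - g i \<bullet> x i else 1 + g i \<bullet> x j)" for i j
  have le1: "\<bar>g i \<bullet> x j\<bar> \<le> 1" for i j
    using abs_polar_le[OF g] x order_trans by blast
  have E: "0 \<le> E i j" for i j using le1[of i j] by (auto simp: E_def abs_le_iff)
  define T where "T = (\<Sum>i\<in>UNIV. \<beta> i * x i $ 3)"
  \<comment> \<open>Evaluate the balance equation at \<open>x j\<close> and eliminate \<open>\<kappa>\<close> by the lower bound for the value.\<close>
  have ineq: "x j $ 3 * (2 * \<beta> j + (c - 1)) + x j $ 3 * (\<Sum>i\<in>UNIV - {j}. \<beta> i * E i i)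
      + (\<Sum>i\<in>UNIV - {j}. \<beta> i * x i $ 3 * E i j) \<le> T" for j
  proof -
    have "(\<Sum>i\<in>UNIV - {j}. \<beta> i * E i i) = (\<Sum>i\<in>UNIV. \<beta> i * E i i) - \<beta> j * E j j"
      by (simp add: sum_diff1)
    also have "\<dots> = 1 - (\<Sum>i\<in>UNIV. \<beta> i * (g i \<bullet> x i)) - \<beta> j * (1 - g j \<bullet> x j)"
      using \<beta>(2) by (simp add: E_def right_diff_distrib sum_subtractf)
    finally have 1: "(\<Sum>i\<in>UNIV - {j}. \<beta> i * E i i) = \<dots>" .
    have "(\<Sum>i\<in>UNIV - {j}. \<beta> i * x i $ 3 * E i j) = (\<Sum>i\<in>UNIV - {j}. \<beta> i * x i $ 3 * (1 + g i \<bullet> x j))"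
      by (rule sum.cong) (auto simp: E_def)
    also have "\<dots> = T + \<kappa> * x j $ 3 - \<beta> j * x j $ 3 * (1 + g j \<bullet> x j)"
      using balance[of "x j"] by (simp add: sum_diff1 T_def distrib_left sum.distrib)
    finally have 2: "(\<Sum>i\<in>UNIV - {j}. \<beta> i * x i $ 3 * E i j) = \<dots>" .
    have "x j $ 3 * (c + \<kappa>) \<le> x j $ 3 * (\<Sum>i\<in>UNIV. \<beta> i * (g i \<bullet> x i))"
      using value_ge t by (rule mult_left_mono)
    then show ?thesis unfolding 1 2 by (simp add: algebra_simps)
  qed
  \<comment> \<open>If all \<open>x i\<close> with positive weight were in the plane, the projection would not move them, and the
    value could not exceed \<open>1\<close>.\<close>
  have "0 < T"
  proof (rule ccontr)
    assume "\<not> 0 < T"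
    have "x j $ 3 = 0" for j
    proof -
      have "0 \<le> x j $ 3 * (\<Sum>i\<in>UNIV - {j}. \<beta> i * E i i)" "0 \<le> (\<Sum>i\<in>UNIV - {j}. \<beta> i * x i $ 3 * E i j)"
        using t \<beta> E by (auto intro!: mult_nonneg_nonneg sum_nonneg)
      then have "x j $ 3 * (2 * \<beta> j + (c - 1)) \<le> 0" using ineq[of j] \<open>\<not> 0 < T\<close> by linarith
      moreover have "0 < 2 * \<beta> j + (c - 1)" using \<beta>(1)[of j] by (simp add: c_def)
      ultimately show ?thesis using t[of j] by (simp add: mult_le_0_iff)
    qed
    then have "\<kappa> = 0" using balance[of "axis 3 1"] by (simp add: axis_def)
    moreover have "(\<Sum>i\<in>UNIV. \<beta> i * (g i \<bullet> x i)) \<le> sum \<beta> UNIV"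
      using \<beta>(1) le1 by (intro sum_mono mult_left_le) (auto simp: abs_le_iff)
    ultimately show False using value_ge \<beta>(2) by (simp add: c_def)
  qed
  have E_small: "E i j \<le> 1/15" for i j
    by (rule near_equality_bounds[of \<beta> "\<lambda>i. x i $ 3" E "c - 1", OF \<beta> t _ E])
      (use \<open>0 < T\<close> ineq in \<open>auto simp: T_def c_def\<close>)
  have diag: "\<bar>g i \<bullet> x i - 1\<bar> \<le> 1/15" for i
    using E_small[of i i] E[of i i] by (simp add: E_def)
  have off: "\<bar>g i \<bullet> x j + 1\<bar> \<le> 1/15" if "i \<noteq> j" for i j
    using E_small[of i j] E[of i j] that by (simp add: E_def)
  obtain a w where aw: "a \<bullet> w = 1" "\<And>z. N (z - (a \<bullet> z) *\<^sub>R w) \<le> 5/4 * N z"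
    by (rule projection_from_almost_cube[of x g, OF x g diag]) (use off in blast)+
  have "N (z - (a \<bullet> z) *\<^sub>R w) \<le> (4/3 - 1/1000) * N z" for z
    by (rule order_trans[OF aw(2)]) (simp add: mult_right_mono N_nonneg)
  with aw(1) none show False by blast
qed

end

theorem corollary3p6:
  assumes "dim (UNIV :: 'a::real_normed_vector set) = 3"
  shows "\<exists>Y :: 'a set. subspace Y \<and> dim Y = 2 \<and> rel_proj_const Y < ereal (4 / 3 - 0.0007)"
proof -
  obtain B :: "'a set" where B: "independent B" "span B = UNIV" "card B = 3"
    using basis_exists[of "UNIV :: 'a set"] assms by (metis top.extremum_uniqueI)
  obtain b1 b2 b3 where b: "B = {b1, b2, b3}" "b1 \<noteq> b2" "b1 \<noteq> b3" "b2 \<noteq> b3"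
    using B(3) by (auto simp: card_3_iff)
  \<comment> \<open>The coordinate isomorphism of a basis carries the norm to \<open>real^3\<close>.\<close>
  define \<phi> :: "real^3 \<Rightarrow> 'a" where "\<phi> v = v$1 *\<^sub>R b1 + v$2 *\<^sub>R b2 + v$3 *\<^sub>R b3" for v
  have lin: "linear \<phi>" unfolding \<phi>_def by (intro linearI) (simp_all add: algebra_simps)
  have ker: "v = 0" if "\<phi> v = 0" for v
  proof -
    define u where "u = (\<lambda>b. if b = b1 then v$1 else if b = b2 then v$2 else v$3)"
    have "(\<Sum>b\<in>B. u b *\<^sub>R b) = 0" using that b by (simp add: \<phi>_def u_def add.assoc)
    then have "u b = 0" if "b \<in> B" for b
      using independentD[OF B(1) _ subset_refl] that b(1) by blast
    from this[of b1] this[of b2] this[of b3] show ?thesis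
      using b by (simp add: u_def vec_eq_iff forall_3)
  qed
  have inj: "inj \<phi>" using ker linear_injective_0[OF lin] by blast
  have "range \<phi> = UNIV"
  proof -
    have "B \<subseteq> range \<phi>"
      unfolding b(1)
      by (auto intro: range_eqI[of _ _ "axis 1 1"] range_eqI[of _ _ "axis 2 1"] range_eqI[of _ _ "axis 3 1"]
          simp: \<phi>_def axis_def)
    moreover have "subspace (range \<phi>)" by (simp add: lin linear_subspace_image)
    ultimately show ?thesis using B(2) span_minimal by (metis top.extremum_uniqueI)
  qed
  then have bij: "bij \<phi>" using inj by (simp add: bij_def)
  define \<psi> where "\<psi> = inv \<phi>"
  have \<psi>: "\<phi> (\<psi> z) = z" "\<psi> (\<phi> v) = v" for z v
    using bij by (simp_all add: \<psi>_def bij_is_surj surj_f_inv_f inj)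
  have lin\<psi>: "linear \<psi>"
    by (rule linearI; rule injD[OF inj]) (simp_all add: linear_add[OF lin] linear_scale[OF lin] \<psi>)
  interpret norm_on_R3 "\<lambda>v. norm (\<phi> v)"
    by unfold_locales (simp_all add: linear_add[OF lin] linear_scale[OF lin] norm_triangle_ineq ker)
  obtain a w where aw: "a \<bullet> w = 1"
      "\<And>z. norm (\<phi> (z - (a \<bullet> z) *\<^sub>R w)) \<le> (4/3 - 1/1000) * norm (\<phi> z)"
    using good_projection by blast
  define Y where "Y = \<phi> ` {v. a \<bullet> v = 0}"
  define P where "P z = \<phi> (\<psi> z - (a \<bullet> \<psi> z) *\<^sub>R w)" for z
  have "a \<noteq> 0" using aw(1) by auto
  have "subspace Y"
    unfolding Y_def by (intro linear_subspace_image lin subspace_hyperplane)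
  moreover have "dim Y = 2"
  proof -
    have "dim Y = dim {v. a \<bullet> v = 0}"
      unfolding Y_def by (rule eucl.dim_image_eq[OF lin]) (rule inj_on_subset[OF inj subset_UNIV])
    then show ?thesis using dim_hyperplane[OF \<open>a \<noteq> 0\<close>] by simp
  qed
  moreover have "rel_proj_const Y < ereal (4 / 3 - 0.0007)"
  proof -
    have bound: "norm (P z) \<le> (4/3 - 1/1000) * norm z" for z
      using aw(2)[of "\<psi> z"] by (simp add: P_def \<psi>)
    have "linear P"
      unfolding P_def
      by (rule linearI) (simp_all add: linear_add[OF lin\<psi>] linear_scale[OF lin\<psi>]
        linear_add[OF lin, symmetric] linear_scale[OF lin, symmetric] algebra_simps)
    then have "bounded_linear P"
      using bound unfolding linear_conv_bounded_linear
      by (intro bounded_linear_intro[of _ "4/3 - 1/1000"]) (auto simp: linear_add linear_scale mult.commute)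
    moreover have "range P \<subseteq> Y"
      using aw(1) by (auto simp: P_def Y_def inner_diff_right)
    moreover have "P y = y" if "y \<in> Y" for y
      using that by (auto simp: P_def Y_def \<psi>)
    ultimately have "P \<in> projections_onto Y" by (simp add: projections_onto_def)
    then have "rel_proj_const Y \<le> ereal (onorm P)"
      unfolding rel_proj_const_def by (rule INF_lower)
    also have "\<dots> \<le> ereal (4/3 - 1/1000)" using onorm_bound[OF _ bound] by simp
    also have "\<dots> < ereal (4 / 3 - 0.0007)" by simp
    finally show ?thesis .
  qed
  ultimately show ?thesis by blast
qed

end
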